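(* Let $n \ge 3$ and let $\boldsymbol{a} = (a_1, a_2, \ldots, a_n)^T$ be a vector of positive integers with $a_1 \le a_2 \le \cdots \le a_n$ whose entries are pairwise coprime, i.e. $\gcd(a_i,a_j)=1$ for all $i,j \in \{1,\ldots,n\}$ with $i \neq j$. Then $$F(\boldsymbol{a}) \le \frac{1}{2}\left(\sqrt{a_1a_2a_3(a_1+a_2+a_3)}-a_1-a_2-a_3\right).$$
   Context: For a vector $\boldsymbol{a}=(a_1,\ldots,a_n)^T$ of positive integers with $n\ge 2$ and $\gcd(a_1,\ldots,a_n)=1$, the Frobenius number is $F(\boldsymbol{a}) := \max\{ b \in \mathbb{Z} : b \ne \sum_{i=1}^n a_i z_i \text{ for all } (z_1,\ldots,z_n) \in \mathbb{Z}_{\ge 0}^n \}$, the largest integer (possibly negative) that is not a nonnegative integer combination of the $a_i$. In particular $F(\boldsymbol{a})=-1$ when some $a_i=1$. *)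

theory Defs
  imports Complex_Main
begin

text \<open>
  The Frobenius number of the integer vector with entries \<open>a 1, \<dots>, a n\<close>; values of \<open>a\<close>
  outside \<open>{1..n}\<close> are irrelevant. The largest element is taken over \<^typ>\<open>int\<close>, since
  it is negative when some entry is 1. The set of non-representable integers is unbounded
  below, so it is not finite and \<^const>\<open>Max\<close> does not apply. The greatest element exists
  for positive entries with greatest common divisor 1; otherwise the value is unspecified.
\<close>

definition frobenius_number :: "nat \<Rightarrow> (nat \<Rightarrow> nat) \<Rightarrow> int" where
  "frobenius_number n a =
     (GREATEST b::int. \<forall>z::nat \<Rightarrow> nat. b \<noteq> (\<Sum>i=1..n. int (a i) * int (z i)))"

end

theory Submission
  imports Defs "HOL-Computational_Algebra.Polynomial_FPS"
begin

text \<open>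
  An integer \<open>m \<ge> 0\<close> that is not a nonnegative combination of \<open>a, b, c\<close> makes the coefficient of
  \<open>x\<^sup>m\<close> in \<open>1 / ((1 - x\<^sup>a) (1 - x\<^sup>b) (1 - x\<^sup>c))\<close> vanish. For pairwise coprime \<open>a, b, c\<close> all poles except 1
  are simple, so the partial fraction decomposition writes this coefficient as an explicit quadratic
  polynomial in \<open>m\<close> (from the pole at 1) plus three Fourier-Dedekind sums. By AM-GM and because
  \<open>z \<mapsto> z\<^sup>b\<close> permutes the \<open>a\<close>-th roots of unity, the sum belonging to \<open>a\<close> is at most
  \<open>(1/a) \<Sum> 1 / |1 - z|\<^sup>2 = (a\<^sup>2 - 1) / (12 a)\<close>, the last equality being Parseval's identity for the
  sawtooth function. Hence the quadratic polynomial is at most the sum of these three bounds,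
  and completing the square yields \<open>(2 m + a + b + c)\<^sup>2 \<le> a b c (a + b + c)\<close>.
\<close>

section \<open>Partial fractions for a triple pole at 1 and simple poles elsewhere\<close>

lemma fps_nth_mult_one_minus_X:
  fixes f :: "'a::comm_ring_1 fps"
  shows "fps_nth (f * (1 - fps_X)) n = (if n = 0 then fps_nth f 0 else fps_nth f n - fps_nth f (n - 1))"
  by (simp add: right_diff_distrib)

text \<open>Differentiating the factorisation and evaluating at \<open>\<mu>\<close> leaves only the
  value of \<open>Q\<close>. This makes \<open>1 / poly (pderiv D) \<mu>\<close> the residue of
  \<open>1 / D\<close> at a simple root.\<close>

lemma poly_quotient_at_root:
  fixes D :: "complex poly"
  assumes "poly D \<mu> = 0"
  defines "Q \<equiv> D div [:-\<mu>, 1:]"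
  shows "[:-\<mu>, 1:] * Q = D" "poly Q \<mu> = poly (pderiv D) \<mu>"
    "D \<noteq> 0 \<Longrightarrow> degree D = Suc (degree Q)"
proof -
  have "[:-\<mu>, 1:] dvd D" using assms(1) by (simp add: poly_eq_0_iff_dvd)
  then show *: "[:-\<mu>, 1:] * Q = D" unfolding Q_def by (rule dvd_mult_div_cancel)
  have "pderiv D = [:-\<mu>, 1:] * pderiv Q + Q * pderiv [:-\<mu>, 1:]"
    unfolding *[symmetric] by (rule pderiv_mult)
  then show "poly Q \<mu> = poly (pderiv D) \<mu>" by (simp add: pderiv_pCons)
  assume "D \<noteq> 0"
  then have "Q \<noteq> 0" using * by auto
  then have "degree ([:-\<mu>, 1:] * Q) = degree [:-\<mu>, 1:] + degree Q"
    by (intro degree_mult_eq) auto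
  then show "degree D = Suc (degree Q)" using * by simp
qed

text \<open>Divided by \<open>D\<close>, the conclusion is the partial fraction decomposition of
  \<open>1 / D\<close>, with \<open>h / W ^ 3\<close> as the part at the triple pole 1. The
  difference \<open>N\<close> of both sides is divisible by \<open>W ^ 3\<close> and vanishes on
  \<open>S\<close>, but its degree is less than \<open>3 + card S\<close>, so it is zero.\<close>

lemma partial_fractions_poly:
  fixes E h :: "complex poly"
  defines "W \<equiv> [:1, -1:]"
  defines "D \<equiv> W ^ 3 * E"
  assumes S: "finite S" "card S = degree E" "1 \<notin> S"
    and root: "\<And>\<mu>. \<mu> \<in> S \<Longrightarrow> poly E \<mu> = 0"
    and simple: "\<And>\<mu>. \<mu> \<in> S \<Longrightarrow> poly (pderiv D) \<mu> \<noteq> 0"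
    and h: "degree h \<le> 2" "W ^ 3 dvd E * h - 1"
  shows "E * h + (\<Sum>\<mu>\<in>S. smult (1 / poly (pderiv D) \<mu>) (D div [:-\<mu>, 1:])) = 1"
proof -
  define Q where "Q \<mu> = D div [:-\<mu>, 1:]" for \<mu>
  define c where "c \<mu> = 1 / poly (pderiv D) \<mu>" for \<mu>
  define N where "N = E * h + (\<Sum>\<mu>\<in>S. smult (c \<mu>) (Q \<mu>)) - 1"
  \<comment> \<open>If \<open>E\<close> were zero, the nonunit \<open>W ^ 3\<close> would divide
    -1.\<close>
  have E0: "E \<noteq> 0" using h(2) is_unit_power_iff[of W 3]
    by (auto simp: W_def is_unit_poly_iff)
  have W0: "W \<noteq> 0" by (simp add: W_def)
  have D0: "D \<noteq> 0" using E0 W0 by (simp add: D_def)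
  have degW: "degree (W ^ 3) = 3" by (simp add: W_def degree_power_eq)
  have degD: "degree D = 3 + degree E"
    using E0 W0 degW by (simp add: D_def degree_mult_eq)
  have Droot: "poly D \<mu> = 0" if "\<mu> \<in> S" for \<mu> using root[OF that] by (simp add: D_def)
  have Q: "[:-\<mu>, 1:] * Q \<mu> = D" "poly (Q \<mu>) \<mu> = poly (pderiv D) \<mu>" "degree (Q \<mu>) = 2 + degree E"
    if "\<mu> \<in> S" for \<mu>
    using poly_quotient_at_root[OF Droot[OF that]] degD D0 by (auto simp: Q_def)
  \<comment> \<open>The linear factor cancels inside \<open>E\<close>, so the factor
    \<open>W ^ 3\<close> of \<open>D\<close> survives the division.\<close>
  have WQ: "W ^ 3 dvd Q \<mu>" if "\<mu> \<in> S" for \<mu>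
  proof -
    have "[:-\<mu>, 1:] dvd E" using root[OF that] by (simp add: poly_eq_0_iff_dvd)
    then obtain R where "E = [:-\<mu>, 1:] * R" by blast
    then have "D = (W ^ 3 * R) * [:-\<mu>, 1:]" by (simp only: D_def mult_ac)
    then have "Q \<mu> = W ^ 3 * R"
      by (simp only: Q_def) (rule nonzero_mult_div_cancel_right, simp)
    then show ?thesis by simp
  qed
  have "N = (E * h - 1) + (\<Sum>\<mu>\<in>S. smult (c \<mu>) (Q \<mu>))" by (simp add: N_def)
  then have "W ^ 3 dvd N" using h(2) WQ by (auto intro!: dvd_add dvd_sum dvd_smult)
  then obtain R where R: "N = W ^ 3 * R" by blast
  have "poly N \<nu> = 0" if \<nu>: "\<nu> \<in> S" for \<nu>
  proof -
    have *: "poly (Q \<mu>) \<nu> = 0" if "\<mu> \<in> S" "\<mu> \<noteq> \<nu>" for \<mu>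
    proof -
      have "poly ([:-\<mu>, 1:] * Q \<mu>) \<nu> = 0" using Q(1)[OF that(1)] Droot[OF \<nu>] by simp
      then show ?thesis using that by auto
    qed
    \<comment> \<open>Lagrange interpolation: only the summand of \<open>\<nu>\<close> survives at
      \<open>\<nu>\<close>, and \<open>c \<nu>\<close> normalises it to 1.\<close>
    have "poly (\<Sum>\<mu>\<in>S. smult (c \<mu>) (Q \<mu>)) \<nu> = (\<Sum>\<mu>\<in>S. if \<mu> = \<nu> then c \<nu> * poly (Q \<nu>) \<nu> else 0)"
      unfolding poly_sum by (intro sum.cong) (auto simp: *)
    also have "\<dots> = 1" using \<nu> S simple[OF \<nu>] Q(2)[OF \<nu>] by (simp add: c_def)
    finally show ?thesis using root[OF \<nu>] by (simp add: N_def)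
  qed
  then have Rroot: "poly R \<nu> = 0" if "\<nu> \<in> S" for \<nu>
    using that S(3) by (force simp: R W_def)
  have "R = 0"
  proof (rule ccontr)
    assume R0: "R \<noteq> 0"
    have "degree (E * h) \<le> degree E + 2" using degree_mult_le[of E h] h(1) by linarith
    moreover have "degree (\<Sum>\<mu>\<in>S. smult (c \<mu>) (Q \<mu>)) \<le> degree E + 2"
      using S(1) Q(3) by (intro degree_sum_le) (auto intro: order_trans[OF degree_smult_le])
    ultimately have "degree N \<le> degree E + 2"
      unfolding N_def by (intro degree_diff_le degree_add_le) auto
    moreover have "degree N = 3 + degree R" using R0 W0 degW by (simp add: R degree_mult_eq)
    ultimately have "degree R < card S" using S(2) by linarith
    moreover have "card S \<le> card {x. poly R x = 0}"
      using Rroot R0 poly_roots_finite by (intro card_mono) auto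
    moreover have "\<dots> \<le> degree R" using R0 by (rule card_poly_roots_bound)
    ultimately show False by linarith
  qed
  then show ?thesis using R by (simp add: N_def c_def Q_def)
qed

text \<open>Here \<open>F\<close> is the power series of \<open>1 / D\<close>. Multiplying the
  polynomial identity by \<open>F\<close> turns \<open>D div [:-\<mu>, 1:]\<close> into
  \<open>1 / (x - \<mu>)\<close>, whose coefficients are \<open>- 1 / \<mu> ^ (n + 1)\<close>, and
  turns the part at 1 into a combination of the powers \<open>1 / (1 - x) ^ k\<close> with
  \<open>k\<close> from 1 to 3.\<close>

lemma partial_fractions_coeff:
  fixes E :: "complex poly" and F :: "complex fps"
  defines "W \<equiv> [:1, -1:]"
  defines "D \<equiv> W ^ 3 * E"
  assumes S: "finite S" "card S = degree E" "1 \<notin> S" "0 \<notin> S"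
    and root: "\<And>\<mu>. \<mu> \<in> S \<Longrightarrow> poly E \<mu> = 0"
    and simple: "\<And>\<mu>. \<mu> \<in> S \<Longrightarrow> poly (pderiv D) \<mu> \<noteq> 0"
    and h: "W ^ 3 dvd E * ([:e0:] + [:e1:] * W + [:e2:] * W ^ 2) - 1"
    and F: "F * fps_of_poly D = 1"
  shows "fps_nth F n = e0 * (of_nat (n + 1) * of_nat (n + 2) / 2) + e1 * of_nat (n + 1) + e2
           - (\<Sum>\<mu>\<in>S. 1 / (poly (pderiv D) \<mu> * \<mu> ^ (n + 1)))"
proof -
  define h where "h = [:e0:] + [:e1:] * W + [:e2:] * W ^ 2"
  define V where "V = fps_of_poly W"
  have V: "V = 1 - fps_X" by (simp add: V_def W_def fps_of_poly_pCons)
  define K where "K \<mu> = Abs_fps (\<lambda>n. - (1 / \<mu> ^ (n + 1)))" for \<mu> :: complex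
  \<comment> \<open>\<open>G1\<close>, \<open>G2\<close>, \<open>G3\<close> are the first three
    powers of \<open>1 / (1 - x)\<close>.\<close>
  define G1 where "G1 = Abs_fps (\<lambda>n. 1 :: complex)"
  define G2 where "G2 = Abs_fps (\<lambda>n. of_nat (n + 1) :: complex)"
  define G3 where "G3 = Abs_fps (\<lambda>n. of_nat (n + 1) * of_nat (n + 2) / 2 :: complex)"
  have G1: "G1 * V = 1" unfolding V G1_def
    by (rule fps_ext, subst fps_nth_mult_one_minus_X) auto
  have G2: "G2 * V = G1" unfolding V G2_def G1_def
    by (rule fps_ext, subst fps_nth_mult_one_minus_X) auto
  have G3: "G3 * V = G2" unfolding V G3_def G2_def
    by (rule fps_ext, subst fps_nth_mult_one_minus_X) (auto simp: field_simps)
  have FD: "F * fps_of_poly E * V ^ 3 = 1"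
    using F by (simp add: D_def V_def fps_of_poly_mult fps_of_poly_power mult_ac)
  have V0: "V \<noteq> 0" using G1 by auto
  have "(F * fps_of_poly E) * V ^ 3 = G3 * V ^ 3"
    unfolding FD using G1 G2 G3 by (simp add: power3_eq_cube mult.assoc[symmetric])
  then have FE: "F * fps_of_poly E = G3" using V0 by simp
  have "degree h \<le> 2"
    unfolding h_def W_def by (simp add: power2_eq_square)
  note N = partial_fractions_poly[OF S(1-3), where h = h, folded W_def, folded D_def,
      OF root simple this, folded h_def, OF _ _ h[folded h_def]]
  have FQ: "F * fps_of_poly (D div [:-\<mu>, 1:]) = K \<mu>" if \<mu>: "\<mu> \<in> S" for \<mu>
  proof -
    have \<mu>0: "\<mu> \<noteq> 0" using \<mu> S(4) by auto
    have K: "K \<mu> * fps_of_poly [:-\<mu>, 1:] = 1"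
    proof (rule fps_ext)
      fix n show "fps_nth (K \<mu> * fps_of_poly [:-\<mu>, 1:]) n = fps_nth 1 n"
        using \<mu>0 by (cases n) (auto simp: K_def fps_of_poly_pCons distrib_left field_simps)
    qed
    have "poly D \<mu> = 0" using root[OF \<mu>] by (simp add: D_def)
    from poly_quotient_at_root(1)[OF this]
    have "F * (fps_of_poly [:-\<mu>, 1:] * fps_of_poly (D div [:-\<mu>, 1:])) = 1"
      using F by (simp add: fps_of_poly_mult[symmetric])
    then have "K \<mu> = K \<mu> * (F * (fps_of_poly [:-\<mu>, 1:] * fps_of_poly (D div [:-\<mu>, 1:])))" by simp
    also have "\<dots> = (K \<mu> * fps_of_poly [:-\<mu>, 1:]) * (F * fps_of_poly (D div [:-\<mu>, 1:]))"
      by (simp only: mult_ac)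
    finally show ?thesis using K by simp
  qed
  have Fh: "F * fps_of_poly (E * h) = fps_const e0 * G3 + fps_const e1 * G2 + fps_const e2 * G1"
  proof -
    have "F * fps_of_poly (E * h) = G3 * fps_of_poly h"
      by (simp add: fps_of_poly_mult FE mult.assoc[symmetric])
    also have "\<dots> = fps_const e0 * G3 + fps_const e1 * (G3 * V) + fps_const e2 * (G3 * V * V)"
      unfolding h_def fps_of_poly_add fps_of_poly_mult fps_of_poly_const fps_of_poly_power V_def[symmetric]
      by (simp add: algebra_simps power2_eq_square)
    finally show ?thesis by (simp add: G2 G3)
  qed
  have "F = F * fps_of_poly (E * h + (\<Sum>\<mu>\<in>S. smult (1 / poly (pderiv D) \<mu>) (D div [:-\<mu>, 1:])))"
    using N by simp
  also have "\<dots> = fps_const e0 * G3 + fps_const e1 * G2 + fps_const e2 * G1 +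
      (\<Sum>\<mu>\<in>S. fps_const (1 / poly (pderiv D) \<mu>) * K \<mu>)"
    unfolding fps_of_poly_add distrib_left Fh fps_of_poly_sum sum_distrib_left
    by (intro arg_cong2[of _ _ _ _ "(+)"] sum.cong) (auto simp: fps_of_poly_smult FQ[symmetric] mult_ac)
  finally have "fps_nth F n = fps_nth \<dots> n" by simp
  then show ?thesis
    by (simp add: fps_sum_nth G1_def G2_def G3_def K_def sum_negf)
qed

section \<open>Roots of unity: orthogonality, Parseval and power maps\<close>

text \<open>Multiplication by a primitive root \<open>w\<close> permutes the roots, so the sum
  equals \<open>w ^ m\<close> times itself, while \<open>w ^ m\<close> differs from 1.\<close>

lemma sum_powers_roots_of_unity:
  assumes "n > 0" "\<not> n dvd m"
  shows "(\<Sum>z | z ^ n = 1. z ^ m :: complex) = 0"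
proof -
  let ?U = "{z::complex. z ^ n = 1}"
  define w where "w = cis (2 * pi / real n)"
  have wn: "w ^ n = 1" using assms by (simp add: w_def DeMoivre)
  have w0: "w \<noteq> 0" by (simp add: w_def)
  have "w ^ m \<noteq> 1"
  proof
    assume "w ^ m = 1"
    then have "w ^ (m mod n) = 1"
      using wn by (metis mult_1 mult_div_mod_eq power_add power_mult power_one)
    moreover have "inj_on (\<lambda>k. cis (2 * pi * real k / real n)) {..<n}"
      using bij_betw_roots_unity[OF assms(1)] by (simp add: bij_betw_def)
    moreover have "cis (2 * pi * real k / real n) = w ^ k" for k
      by (simp add: w_def DeMoivre mult_ac)
    ultimately have "m mod n = 0" using assms(1) unfolding inj_on_def
      by (metis lessThan_iff mod_less_divisor power_0)
    then show False using assms(2) by auto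
  qed
  have "bij_betw ((*) w) ?U ?U"
    by (rule bij_betwI[where g = "\<lambda>z. z / w"]) (use wn w0 in \<open>auto simp: power_mult_distrib power_divide\<close>)
  then have "(\<Sum>z\<in>?U. z ^ m) = (\<Sum>z\<in>?U. (w * z) ^ m)"
    by (rule sum.reindex_bij_betw[symmetric])
  also have "\<dots> = w ^ m * (\<Sum>z\<in>?U. z ^ m)" by (simp add: power_mult_distrib sum_distrib_left)
  finally show ?thesis using \<open>w ^ m \<noteq> 1\<close> by simp
qed

text \<open>On the unit circle conjugation inverts, so each term is
  \<open>z ^ (j + (n - k))\<close>. This exponent lies strictly between 0 and \<open>2 * n\<close>,
  so it is a multiple of \<open>n\<close> only for \<open>j = k\<close>.\<close>

lemma sum_cnj_powers_roots_of_unity: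
  assumes "n > 0" "j < n" "k < n"
  shows "(\<Sum>z | z ^ n = 1. z ^ j * cnj (z ^ k)) = (if j = k then of_nat n else 0)"
proof -
  have *: "z ^ j * cnj (z ^ k) = z ^ (j + (n - k))" if "z ^ n = 1" for z :: complex
  proof -
    have "norm z = 1" using that assms(1) by (metis power_eq_1_iff less_numeral_extra(3))
    then have "z * cnj z = 1" by (simp add: complex_norm_square[symmetric])
    then have "z ^ k * cnj (z ^ k) = 1" by (simp add: power_mult_distrib[symmetric])
    moreover have "z ^ k * z ^ (n - k) = 1" using that assms(3) by (simp add: power_add[symmetric])
    ultimately have "cnj (z ^ k) = z ^ (n - k)"
      by (metis mult.assoc mult.commute mult_1)
    then show ?thesis by (simp add: power_add)
  qed
  have "(\<Sum>z | z ^ n = 1. z ^ j * cnj (z ^ k)) = (\<Sum>z | z ^ n = 1. z ^ (j + (n - k)))"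
    by (intro sum.cong) (auto simp: * simp del: complex_cnj_power)
  also have "\<dots> = (if j = k then of_nat n else 0)"
  proof (cases "j = k")
    case True
    then show ?thesis using assms card_roots_unity_eq[OF assms(1)] by simp
  next
    case False
    have "\<not> n dvd j + (n - k)"
    proof
      assume "n dvd j + (n - k)"
      then obtain q where q: "j + (n - k) = n * q" by blast
      have "0 < j + (n - k)" "j + (n - k) < n * 2" using assms by auto
      then have "q > 0" "q < 2" using q assms(1) by (auto intro: gr0I)
      then have "q = 1" by simp
      then show False using q False assms by simp
    qed
    then show ?thesis using sum_powers_roots_of_unity[OF assms(1)] False by simp
  qed
  finally show ?thesis .
qed

lemma parseval_roots_of_unity:
  fixes f :: "nat \<Rightarrow> real"
  assumes "n > 0"
  shows "(\<Sum>z | z ^ n = 1. (norm (\<Sum>k<n. of_real (f k) * z ^ k :: complex))\<^sup>2) = n * (\<Sum>k<n. (f k)\<^sup>2)"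
proof -
  have "complex_of_real (\<Sum>z | z ^ n = 1. (norm (\<Sum>k<n. of_real (f k) * z ^ k :: complex))\<^sup>2)
      = (\<Sum>z | z ^ n = 1. \<Sum>j<n. \<Sum>k<n. of_real (f j * f k) * (z ^ j * cnj (z ^ k)))"
    unfolding of_real_sum complex_norm_square cnj_sum sum_product
    by (intro sum.cong) (auto simp: mult_ac)
  also have "\<dots> = (\<Sum>j<n. \<Sum>z | z ^ n = 1. \<Sum>k<n. of_real (f j * f k) * (z ^ j * cnj (z ^ k)))"
    by (rule sum.swap)
  also have "\<dots> = (\<Sum>j<n. \<Sum>k<n. \<Sum>z | z ^ n = 1. of_real (f j * f k) * (z ^ j * cnj (z ^ k)))"
    by (intro sum.cong refl sum.swap)
  also have "\<dots> = (\<Sum>j<n. \<Sum>k<n. of_real (f j * f k) * (if j = k then of_nat n else 0))"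
    unfolding sum_distrib_left[symmetric]
    by (intro sum.cong refl arg_cong2[of _ _ _ _ "(*)"] sum_cnj_powers_roots_of_unity assms) auto
  also have "\<dots> = (\<Sum>j<n. \<Sum>k<n. if k = j then of_nat n * of_real ((f j)\<^sup>2) else 0)"
    by (intro sum.cong refl) (auto simp: power2_eq_square)
  also have "\<dots> = of_real (n * (\<Sum>k<n. (f k)\<^sup>2))"
    by (simp add: sum_distrib_left)
  finally show ?thesis by (simp only: of_real_eq_iff)
qed

text \<open>The transform \<open>g\<close> of the centred sawtooth \<open>f\<close> satisfies
  \<open>(1 - z) * g z = - n\<close> at the nontrivial roots. Parseval then reduces the claim to the
  sum of the squares of \<open>f\<close>.\<close>

lemma sum_inverse_norm_one_minus_root_of_unity:
  assumes "n > 0"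
  shows "(\<Sum>z | z ^ n = 1 \<and> z \<noteq> 1. 1 / (norm (1 - z :: complex))\<^sup>2) = ((real n)\<^sup>2 - 1) / 12"
proof -
  \<comment> \<open>Subtracting the mean gives \<open>g 1 = 0\<close>, so the root 1 adds nothing to
    the Parseval sum.\<close>
  define f where "f k = real k - (real n - 1) / 2" for k
  define g where "g z = (\<Sum>k<n. of_real (f k) * z ^ k :: complex)" for z
  have sf: "(\<Sum>k<m. f k) = real m * (real m - real n) / 2" for m
    by (induction m) (auto simp: f_def field_simps)
  \<comment> \<open>The shift in \<open>f\<close> depends on \<open>n\<close>; a free shift
    \<open>t\<close> stays fixed during the induction on \<open>m\<close>. The case used is
    \<open>m = n\<close>, \<open>t = (n - 1) / 2\<close>.\<close>
  have sf2: "(\<Sum>k<m. (real k - t)\<^sup>2) = m * (m - 1) * (2 * m - 1) / 6 - t * m * (m - 1) + m * t\<^sup>2" for m and t :: real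
    by (induction m) (auto simp: field_simps power2_eq_square)
  have g1: "g 1 = 0" using sf[of n] by (simp add: g_def flip: of_real_sum)
  have gz: "(norm (g z))\<^sup>2 = (real n)\<^sup>2 * (1 / (norm (1 - z))\<^sup>2)" if "z ^ n = 1" "z \<noteq> 1" for z
  proof -
    \<comment> \<open>Summation by parts; for \<open>m = n\<close> the geometric sum vanishes and
      the last term becomes the constant \<open>n\<close>.\<close>
    have "(1 - z) * (\<Sum>k<m. of_nat k * z ^ k) = z * (\<Sum>k<m. z ^ k) - of_nat m * z ^ m" for m
      by (induction m) (simp_all add: distrib_left left_diff_distrib distrib_right)
    from this[of n] have "(1 - z) * (\<Sum>k<n. of_nat k * z ^ k) = z * (\<Sum>k<n. z ^ k) - of_nat n"
      using that by simp
    moreover have "(\<Sum>k<n. z ^ k) = 0" using that by (simp add: geometric_sum)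
    moreover have "g z = (\<Sum>k<n. of_nat k * z ^ k) - of_real ((real n - 1) / 2) * (\<Sum>k<n. z ^ k)"
      unfolding g_def f_def by (simp only: of_real_diff of_real_of_nat_eq left_diff_distrib sum_subtractf sum_distrib_left)
    ultimately have "(1 - z) * g z = - of_nat n" by simp
    then have "norm (1 - z) * norm (g z) = real n" by (metis norm_mult norm_minus_cancel norm_of_nat)
    moreover have "norm (1 - z) \<noteq> 0" using that by simp
    ultimately have "norm (g z) = real n / norm (1 - z)" by (simp add: field_simps)
    then show ?thesis by (simp add: power_divide)
  qed
  let ?U = "{z::complex. z ^ n = 1}"
  have fin: "finite ?U" using assms by (intro finite_roots_unity) auto
  have *: "{z. z ^ n = 1 \<and> z \<noteq> 1} = ?U - {1}" by auto
  have "(real n)\<^sup>2 * (\<Sum>z | z ^ n = 1 \<and> z \<noteq> 1. 1 / (norm (1 - z :: complex))\<^sup>2) = (\<Sum>z\<in>?U - {1}. (norm (g z))\<^sup>2)"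
    unfolding sum_distrib_left * by (intro sum.cong) (auto simp: gz)
  also have "\<dots> = (\<Sum>z\<in>?U. (norm (g z))\<^sup>2)"
    using fin g1 by (subst sum.remove[of ?U 1]) auto
  also have "\<dots> = n * (\<Sum>k<n. (f k)\<^sup>2)"
    unfolding g_def by (rule parseval_roots_of_unity[OF assms])
  also have "\<dots> = (real n)\<^sup>2 * (((real n)\<^sup>2 - 1) / 12)"
    unfolding f_def sf2 by (simp add: field_simps power2_eq_square)
  finally show ?thesis using assms by simp
qed

text \<open>A Bezout relation \<open>m * x = n * y + 1\<close> makes \<open>z ^ x\<close> the
  inverse map.\<close>

lemma bij_betw_power_roots_of_unity:
  assumes "n > 0" "coprime n m"
  shows "bij_betw (\<lambda>z::complex. z ^ m) {z. z ^ n = 1 \<and> z \<noteq> 1} {z. z ^ n = 1 \<and> z \<noteq> 1}"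
proof (cases "m = 0")
  case True
  \<comment> \<open>In this degenerate case there are no nontrivial roots, so both sets are
    empty.\<close>
  then have "n = 1" using assms by simp
  then show ?thesis by (simp add: bij_betw_def)
next
  case False
  then obtain x y where xy: "m * x = n * y + 1"
    using bezout_nat[of m n] assms(2) by (auto simp: coprime_iff_gcd_eq_1 gcd.commute)
  have inv: "(z ^ m) ^ x = z" if "z ^ n = 1" for z :: complex
    using that by (simp add: power_mult[symmetric] xy power_add) (simp add: power_mult)
  have sub: "(z ^ k) ^ n = 1" if "z ^ n = 1" for z :: complex and k
    using that by (metis mult.commute power_mult power_one)
  show ?thesis
  proof (rule bij_betwI[where g = "\<lambda>z. z ^ x"])
    show "(\<lambda>z. z ^ m) \<in> {z::complex. z ^ n = 1 \<and> z \<noteq> 1} \<rightarrow> {z. z ^ n = 1 \<and> z \<noteq> 1}"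
      using inv sub by (auto, metis power_one)
    have inv': "(z ^ x) ^ m = z" if "z ^ n = 1" for z :: complex
      using inv[OF that] by (simp add: power_mult[symmetric] mult.commute)
    show "(\<lambda>z. z ^ x) \<in> {z::complex. z ^ n = 1 \<and> z \<noteq> 1} \<rightarrow> {z. z ^ n = 1 \<and> z \<noteq> 1}"
      using inv' sub by (auto, metis power_one)
    show "(z ^ m) ^ x = z" if "z \<in> {z. z ^ n = 1 \<and> z \<noteq> 1}" for z :: complex using inv that by auto
    show "(z ^ x) ^ m = z" if "z \<in> {z. z ^ n = 1 \<and> z \<noteq> 1}" for z :: complex using inv' that by auto
  qed
qed

section \<open>Expansions at 1 modulo the cube of \<open>1 - x\<close>\<close>

lemma cube_dvd_trunc_mult:
  fixes w :: "'a::comm_ring_1"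
  shows "w ^ 3 dvd (p0 + p1 * w + p2 * w ^ 2) * (q0 + q1 * w + q2 * w ^ 2)
           - (p0 * q0 + (p0 * q1 + p1 * q0) * w + (p0 * q2 + p1 * q1 + p2 * q0) * w ^ 2)"
  by (rule dvdI[where k = "p1 * q2 + p2 * q1 + p2 * q2 * w"])
    (simp add: algebra_simps power2_eq_square power3_eq_cube)

text \<open>Applied to the truncated inverses of three geometric polynomials, this yields the
  truncated inverse of their product, that is, the three coefficients at the triple pole.\<close>

lemma cube_dvd_trunc_mult3:
  fixes w :: "'a::comm_ring_1"
  shows "w ^ 3 dvd (p0 + p1 * w + p2 * w ^ 2) * (q0 + q1 * w + q2 * w ^ 2) * (r0 + r1 * w + r2 * w ^ 2)
           - (p0 * q0 * r0 + (p0 * q0 * r1 + (p0 * q1 + p1 * q0) * r0) * w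
              + (p0 * q0 * r2 + (p0 * q1 + p1 * q0) * r1 + (p0 * q2 + p1 * q1 + p2 * q0) * r0) * w ^ 2)"
    (is "_ dvd ?P * ?Q * ?R - ?T")
proof -
  define U where "U = p0 * q0 + (p0 * q1 + p1 * q0) * w + (p0 * q2 + p1 * q1 + p2 * q0) * w ^ 2"
  have "?P * ?Q * ?R - ?T = (?P * ?Q - U) * ?R + (U * ?R - ?T)" by (simp add: algebra_simps)
  moreover have "w ^ 3 dvd ?P * ?Q - U" unfolding U_def by (rule cube_dvd_trunc_mult)
  moreover have "w ^ 3 dvd U * ?R - ?T" unfolding U_def by (rule cube_dvd_trunc_mult)
  ultimately show ?thesis by (metis dvd_add dvd_mult2)
qed

lemma dvd_mult_diff_one:
  fixes w :: "'a::comm_ring_1"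
  assumes "w dvd x - 1" "w dvd y - 1"
  shows "w dvd x * y - 1"
proof -
  have "x * y - 1 = (x - 1) * y + (y - 1)" by (simp add: algebra_simps)
  then show ?thesis using assms by (metis dvd_add dvd_mult2)
qed

text \<open>This is \<open>(1 - x ^ n) / (1 - x)\<close>: the pole at 1 is split off and only the
  nontrivial roots of unity remain.\<close>

definition geom_poly :: "nat \<Rightarrow> complex poly" where
  "geom_poly n = (\<Sum>k<n. monom 1 k)"

lemma geom_poly_telescope: "[:1, -1:] * geom_poly n = 1 - monom 1 n"
proof (induction n)
  case (Suc n)
  have "[:1, -1:] * geom_poly (Suc n) = [:1, -1:] * geom_poly n + [:1, -1:] * monom 1 n"
    by (simp only: geom_poly_def sum.lessThan_Suc distrib_left)
  also have "\<dots> = 1 - monom 1 (Suc n)" unfolding Suc by (simp add: monom_Suc)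
  finally show ?case .
qed (simp add: geom_poly_def monom_0 one_pCons)

lemma poly_geom_poly_eq_0: "z ^ n = 1 \<Longrightarrow> z \<noteq> 1 \<Longrightarrow> poly (geom_poly n) z = 0"
  using arg_cong[OF geom_poly_telescope, of "\<lambda>p. poly p z" n] by (simp add: poly_monom)

lemma degree_geom_poly:
  assumes "n > 0"
  shows "degree (geom_poly n) = n - 1" "geom_poly n \<noteq> 0"
proof -
  have d: "degree (1 - monom 1 n :: complex poly) = n"
    using assms degree_add_eq_right[of 1 "- monom 1 n :: complex poly"] by (simp add: degree_monom_eq)
  then show *: "geom_poly n \<noteq> 0" using assms geom_poly_telescope[of n] by auto
  have "degree ([:1, -1:] * geom_poly n) = degree [:1, -1 :: complex:] + degree (geom_poly n)"
    using * by (intro degree_mult_eq) auto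
  then show "degree (geom_poly n) = n - 1" unfolding geom_poly_telescope d by simp
qed

text \<open>With \<open>w = 1 - x\<close> this is the binomial expansion of
  \<open>(1 - w) ^ n\<close> up to order 2.\<close>

lemma monom_expand_at_1:
  "\<exists>R. monom 1 n = 1 - [:of_nat n:] * [:1, -1:] + [:of_nat n * (of_nat n - 1) / 2 :: complex:] * [:1, -1:] ^ 2
         + [:1, -1:] ^ 3 * R"
proof (induction n)
  case (Suc n)
  have alg: "(1 - u * w + v * w ^ 2 + w ^ 3 * R) * (1 - w)
      = 1 - (u + 1) * w + (v + u) * w ^ 2 + w ^ 3 * (R * (1 - w) - v)" for u v w R :: "complex poly"
    by (simp add: algebra_simps power2_eq_square power3_eq_cube)
  define u v where "u = [:of_nat n :: complex:]" and "v = [:of_nat n * (of_nat n - 1) / 2 :: complex:]"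
  obtain R where R: "monom 1 n = 1 - u * [:1, -1:] + v * [:1, -1:] ^ 2 + [:1, -1:] ^ 3 * R"
    using Suc unfolding u_def v_def by blast
  have "monom 1 (Suc n) = monom 1 n * (1 - [:1, -1 :: complex:])" by (simp add: monom_Suc one_pCons)
  moreover have "[:of_nat (Suc n):] = u + 1" by (simp add: u_def one_pCons)
  moreover have "[:of_nat (Suc n) * (of_nat (Suc n) - 1) / 2:] = v + u"
    by (simp add: u_def v_def field_simps)
  ultimately show ?case unfolding R alg by auto
qed (simp add: monom_0 one_pCons)

text \<open>Summing the expansions of the monomials raises each binomial coefficient by one step;
  the coefficients are, up to sign, the binomials of \<open>n\<close> over 1, 2 and 3.\<close>

lemma geom_poly_expand_at_1:
  "\<exists>R. geom_poly n = [:of_nat n:] - [:of_nat n * (of_nat n - 1) / 2:] * [:1, -1:]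
         + [:of_nat n * (of_nat n - 1) * (of_nat n - 2) / 6:] * [:1, -1:] ^ 2 + [:1, -1:] ^ 3 * R"
proof (induction n)
  case (Suc n)
  have alg: "(t - u * w + v * w ^ 2 + w ^ 3 * R) + (1 - t * w + u * w ^ 2 + w ^ 3 * R')
      = (t + 1) - (u + t) * w + (v + u) * w ^ 2 + w ^ 3 * (R + R')" for t u v w R R' :: "complex poly"
    by (simp add: algebra_simps)
  define t u v where "t = [:of_nat n :: complex:]" and "u = [:of_nat n * (of_nat n - 1) / 2 :: complex:]"
    and "v = [:of_nat n * (of_nat n - 1) * (of_nat n - 2) / 6 :: complex:]"
  obtain R where R: "geom_poly n = t - u * [:1, -1:] + v * [:1, -1:] ^ 2 + [:1, -1:] ^ 3 * R"
    using Suc unfolding t_def u_def v_def by blast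
  obtain R' where R': "monom 1 n = 1 - t * [:1, -1:] + u * [:1, -1:] ^ 2 + [:1, -1:] ^ 3 * R'"
    using monom_expand_at_1[of n] unfolding t_def u_def by blast
  have "geom_poly (Suc n) = geom_poly n + monom 1 n" by (simp add: geom_poly_def)
  moreover have "[:of_nat (Suc n):] = t + 1" by (simp add: t_def one_pCons)
  moreover have "[:of_nat (Suc n) * (of_nat (Suc n) - 1) / 2:] = u + t"
    by (simp add: t_def u_def field_simps)
  moreover have "[:of_nat (Suc n) * (of_nat (Suc n) - 1) * (of_nat (Suc n) - 2) / 6:] = v + u"
    by (simp add: u_def v_def field_simps)
  ultimately show ?case unfolding R R' alg by metis
qed (simp add: geom_poly_def)

text \<open>The three coefficients solve the triangular system that makes the product with the
  expansion at 1 equal to 1 up to order 2.\<close>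

lemma geom_poly_inverse_mod_cube:
  assumes "n > 0"
  shows "[:1, -1:] ^ 3 dvd geom_poly n * ([:1 / of_nat n:] + [:(of_nat n - 1) / (2 * of_nat n):] * [:1, -1:]
           + [:((of_nat n)\<^sup>2 - 1) / (12 * of_nat n):] * [:1, -1:] ^ 2) - 1"
proof -
  have alg: "(t - u * w + v * w ^ 2 + w ^ 3 * R) * (p + q * w + r * w ^ 2) - 1
      = (t * p - 1) + (t * q - u * p) * w + (t * r - u * q + v * p) * w ^ 2
        + w ^ 3 * (R * (p + q * w + r * w ^ 2) + (v * q - u * r) + v * r * w)"
    for t u v w p q r R :: "complex poly"
    by (simp add: algebra_simps power2_eq_square power3_eq_cube)
  obtain R where R: "geom_poly n = [:of_nat n:] - [:of_nat n * (of_nat n - 1) / 2:] * [:1, -1:]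
         + [:of_nat n * (of_nat n - 1) * (of_nat n - 2) / 6:] * [:1, -1:] ^ 2 + [:1, -1:] ^ 3 * R"
    using geom_poly_expand_at_1 by blast
  have 0: "[:of_nat n:] * [:1 / of_nat n :: complex:] - 1 = 0"
    "[:of_nat n:] * [:(of_nat n - 1) / (2 * of_nat n):] - [:of_nat n * (of_nat n - 1) / 2:] * [:1 / of_nat n :: complex:] = 0"
    "[:of_nat n:] * [:((of_nat n)\<^sup>2 - 1) / (12 * of_nat n):]
        - [:of_nat n * (of_nat n - 1) / 2:] * [:(of_nat n - 1) / (2 * of_nat n) :: complex:]
        + [:of_nat n * (of_nat n - 1) * (of_nat n - 2) / 6:] * [:1 / of_nat n :: complex:] = 0"
    using assms by (auto simp: one_pCons field_simps power2_eq_square)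
  show ?thesis unfolding R alg 0 by simp
qed

section \<open>The simple poles and their residues\<close>

definition nontriv_roots :: "nat \<Rightarrow> complex set" where
  "nontriv_roots n = {z. z ^ n = 1 \<and> z \<noteq> 1}"

lemma nontriv_roots:
  assumes "n > 0"
  shows "finite (nontriv_roots n)" "card (nontriv_roots n) = n - 1" "0 \<notin> nontriv_roots n"
proof -
  have *: "nontriv_roots n = {z. z ^ n = 1} - {1}" by (auto simp: nontriv_roots_def)
  have "finite {z::complex. z ^ n = 1}" using assms by (intro finite_roots_unity) auto
  then show "finite (nontriv_roots n)" "card (nontriv_roots n) = n - 1"
    using card_roots_unity_eq[OF assms] by (auto simp: *)
  show "0 \<notin> nontriv_roots n" using assms by (simp add: nontriv_roots_def power_0_left)
qed

lemma nontriv_roots_power_neq_1: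
  assumes "n > 0" "coprime n m" "z \<in> nontriv_roots n"
  shows "z ^ m \<noteq> 1"
  using bij_betwE[OF bij_betw_power_roots_of_unity[OF assms(1,2)]] assms(3)
  by (auto simp: nontriv_roots_def)

lemma nontriv_roots_disjoint:
  assumes "n > 0" "coprime n m"
  shows "nontriv_roots n \<inter> nontriv_roots m = {}"
  using nontriv_roots_power_neq_1[OF assms] by (auto simp: nontriv_roots_def)

text \<open>In the product rule, the term that keeps the factor \<open>1 - z ^ n\<close>
  vanishes.\<close>

lemma pderiv_at_nontriv_root:
  fixes z :: complex
  assumes "z ^ n = 1"
  shows "poly (pderiv ((1 - monom 1 n) * Q)) z = - (of_nat n * z ^ (n - 1)) * poly Q z"
  using assms by (simp add: pderiv_mult pderiv_diff pderiv_monom poly_monom)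

text \<open>Since \<open>z\<close> has norm 1, each term has norm
  \<open>1 / (a * |1 - z ^ b| * |1 - z ^ c|)\<close>, whatever \<open>m\<close> is. AM-GM separates
  the two factors, and the permutations \<open>z ^ b\<close> and \<open>z ^ c\<close> reduce both
  sums to the known one. Coprimality also keeps the two factors nonzero, so the roots are
  simple.\<close>

lemma sum_norm_residues_le:
  fixes D :: "complex poly"
  assumes "a > 0" "coprime a b" "coprime a c"
    and D: "D = (1 - monom 1 a) * ((1 - monom 1 b) * (1 - monom 1 c))"
  shows "(\<Sum>z\<in>nontriv_roots a. norm (1 / (poly (pderiv D) z * z ^ m))) \<le> ((real a)\<^sup>2 - 1) / (12 * real a)"
    and "\<And>z. z \<in> nontriv_roots a \<Longrightarrow> poly (pderiv D) z \<noteq> 0"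
proof -
  have ineq: "1 / (real a * (x * y)) \<le> 1 / (2 * real a) * (1 / x\<^sup>2 + 1 / y\<^sup>2)" for x y :: real
  proof -
    have "1 / (2 * real a) * (2 * (1 / x) * (1 / y)) \<le> 1 / (2 * real a) * (1 / x\<^sup>2 + 1 / y\<^sup>2)"
      using sum_squares_bound[of "1 / x" "1 / y"] by (intro mult_left_mono) (auto simp: power_divide)
    then show ?thesis by simp
  qed
  have norm_term: "norm (1 / (poly (pderiv D) z * z ^ m)) = 1 / (real a * (norm (1 - z ^ b) * norm (1 - z ^ c)))"
    if "z \<in> nontriv_roots a" for z
  proof -
    have z: "z ^ a = 1" using that by (simp add: nontriv_roots_def)
    then have "norm z = 1" using assms(1) by (metis power_eq_1_iff less_numeral_extra(3))
    then show ?thesis unfolding D pderiv_at_nontriv_root[OF z]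
      by (simp add: norm_mult norm_power norm_divide poly_monom)
  qed
  have pw: "(\<Sum>z\<in>nontriv_roots a. 1 / (norm (1 - z ^ k))\<^sup>2) = ((real a)\<^sup>2 - 1) / 12" if "coprime a k" for k
    using sum.reindex_bij_betw[OF bij_betw_power_roots_of_unity[OF assms(1) that], of "\<lambda>z. 1 / (norm (1 - z))\<^sup>2"]
      sum_inverse_norm_one_minus_root_of_unity[OF assms(1)] by (simp add: nontriv_roots_def)
  have "(\<Sum>z\<in>nontriv_roots a. norm (1 / (poly (pderiv D) z * z ^ m)))
      \<le> (\<Sum>z\<in>nontriv_roots a. 1 / (2 * real a) * (1 / (norm (1 - z ^ b))\<^sup>2 + 1 / (norm (1 - z ^ c))\<^sup>2))"
    by (intro sum_mono) (simp only: norm_term ineq)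
  also have "\<dots> = 1 / (2 * real a) * (((real a)\<^sup>2 - 1) / 12 + ((real a)\<^sup>2 - 1) / 12)"
    unfolding sum_distrib_left[symmetric] sum.distrib pw[OF assms(2)] pw[OF assms(3)] ..
  finally show "(\<Sum>z\<in>nontriv_roots a. norm (1 / (poly (pderiv D) z * z ^ m))) \<le> ((real a)\<^sup>2 - 1) / (12 * real a)"
    by simp
  show "poly (pderiv D) z \<noteq> 0" if "z \<in> nontriv_roots a" for z
  proof -
    have z: "z ^ a = 1" using that by (simp add: nontriv_roots_def)
    then have "z \<noteq> 0" using assms(1) by (auto simp: power_0_left)
    then show ?thesis unfolding D pderiv_at_nontriv_root[OF z]
      using assms(1) nontriv_roots_power_neq_1[OF assms(1,2) that] nontriv_roots_power_neq_1[OF assms(1,3) that]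
      by (simp add: poly_monom)
  qed
qed

section \<open>The generating function and the quadratic bound\<close>

text \<open>For positive \<open>a\<close> this is the power series of
  \<open>1 / (1 - x ^ a)\<close>.\<close>

definition multiples_fps :: "nat \<Rightarrow> complex fps" where
  "multiples_fps a = Abs_fps (\<lambda>n. if a dvd n then 1 else 0)"

lemma multiples_fps_mult:
  assumes "a > 0"
  shows "multiples_fps a * fps_of_poly (1 - monom 1 a) = 1"
proof (rule fps_ext)
  fix n
  have "a dvd n - a \<longleftrightarrow> a dvd n" if "n \<ge> a" using that by (metis dvd_minus_self leD)
  moreover have "\<not> a dvd n" if "n < a" "n > 0" using that by (auto dest: dvd_imp_le)
  ultimately show "fps_nth (multiples_fps a * fps_of_poly (1 - monom 1 a)) n = fps_nth 1 n"
    using assms by (auto simp: multiples_fps_def fps_of_poly_diff fps_of_poly_monom' right_diff_distrib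
        fps_X_power_mult_right_nth)
qed

text \<open>A nonzero term of the convolution would split \<open>n\<close> into multiples of
  \<open>a\<close>, \<open>b\<close> and \<open>c\<close>.\<close>

lemma multiples_fps_nth_eq_0:
  assumes "\<And>x y z. n \<noteq> a * x + b * y + c * z"
  shows "fps_nth (multiples_fps a * multiples_fps b * multiples_fps c) n = 0"
  unfolding fps_mult_nth sum_distrib_right
proof (intro sum.neutral ballI)
  fix i j assume ij: "i \<in> {0..n}" "j \<in> {0..i}"
  have "n = j + (i - j) + (n - i)" using ij by simp
  then have "\<not> (a dvd j \<and> b dvd i - j \<and> c dvd n - i)"
    using assms by (metis dvdE)
  then show "fps_nth (multiples_fps a) j * fps_nth (multiples_fps b) (i - j) * fps_nth (multiples_fps c) (n - i) = 0"
    by (auto simp: multiples_fps_def)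
qed

lemma nonrepresentable_quadratic_bound:
  fixes a b c n :: nat
  assumes pos: "a > 0" "b > 0" "c > 0"
    and cop: "coprime a b" "coprime a c" "coprime b c"
    and nonrep: "\<And>x y z. n \<noteq> a * x + b * y + c * z"
  shows "(2 * real n + real a + real b + real c)\<^sup>2 \<le> real a * real b * real c * (real a + real b + real c)"
proof -
  define W where "W = [:1, -1 :: complex:]"
  define E where "E = geom_poly a * geom_poly b * geom_poly c"
  define D where "D = W ^ 3 * E"
  define S where "S = nontriv_roots a \<union> nontriv_roots b \<union> nontriv_roots c"
  define A B C where "A = real a" and "B = real b" and "C = real c"
  define p1 where "p1 x = (x - 1) / (2 * x)" for x :: real
  \<comment> \<open>\<open>p2\<close> has two roles: quadratic coefficient of the truncated inverse,
    and bound for a residue sum.\<close>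
  define p2 where "p2 x = (x\<^sup>2 - 1) / (12 * x)" for x :: real
  define e0 where "e0 = 1 / A * (1 / B) * (1 / C)"
  \<comment> \<open>\<open>e0\<close>, \<open>e1\<close>, \<open>e2\<close> are the coefficients of
    the truncated triple product, arranged as in \<open>cube_dvd_trunc_mult3\<close>.\<close>
  define e1 where "e1 = 1 / A * (1 / B) * p1 C + (1 / A * p1 B + p1 A * (1 / B)) * (1 / C)"
  define e2 where "e2 = 1 / A * (1 / B) * p2 C + (1 / A * p1 B + p1 A * (1 / B)) * p1 C
      + (1 / A * p2 B + p1 A * p1 B + p2 A * (1 / B)) * (1 / C)"
  define F where "F = multiples_fps a * multiples_fps b * multiples_fps c"
  have cop': "coprime b a" "coprime c a" "coprime c b" using cop by (simp_all add: coprime_commute)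
  have D: "D = (1 - monom 1 a) * ((1 - monom 1 b) * (1 - monom 1 c))"
    unfolding D_def E_def W_def geom_poly_telescope[symmetric] by (simp only: power3_eq_cube mult_ac)
  have Db: "D = (1 - monom 1 b) * ((1 - monom 1 a) * (1 - monom 1 c))" unfolding D by (simp only: mult_ac)
  have Dc: "D = (1 - monom 1 c) * ((1 - monom 1 a) * (1 - monom 1 b))" unfolding D by (simp only: mult_ac)
  note bd = sum_norm_residues_le[OF pos(1) cop(1,2) D] sum_norm_residues_le[OF pos(2) cop'(1) cop(3) Db]
    sum_norm_residues_le[OF pos(3) cop'(2,3) Dc]
  have disj: "nontriv_roots a \<inter> nontriv_roots b = {}"
    "(nontriv_roots a \<union> nontriv_roots b) \<inter> nontriv_roots c = {}"
    using nontriv_roots_disjoint pos cop by blast+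
  have fin: "finite (nontriv_roots a)" "finite (nontriv_roots b)" "finite (nontriv_roots c)"
    using pos nontriv_roots(1) by auto
  have S: "finite S" "1 \<notin> S" "0 \<notin> S"
    using fin pos nontriv_roots(3) by (auto simp: S_def nontriv_roots_def)
  have "degree E = (a - 1) + (b - 1) + (c - 1)"
    unfolding E_def using pos by (simp add: degree_mult_eq degree_geom_poly)
  also have "\<dots> = card S"
    unfolding S_def using disj fin pos by (simp add: card_Un_disjoint nontriv_roots(2))
  finally have cardS: "card S = degree E" by simp
  have root: "poly E z = 0" if "z \<in> S" for z
    using that by (auto simp: E_def S_def nontriv_roots_def poly_geom_poly_eq_0)
  have simple: "poly (pderiv D) z \<noteq> 0" if "z \<in> S" for z
    using that bd(2,4,6) by (auto simp: S_def)
  define H where "H n = [:1 / of_nat n:] + [:(of_nat n - 1) / (2 * of_nat n):] * W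
           + [:((of_nat n)\<^sup>2 - 1) / (12 * of_nat n):] * W ^ 2" for n
  define h where "h = [:complex_of_real e0:] + [:complex_of_real e1:] * W + [:complex_of_real e2:] * W ^ 2"
  have inv: "W ^ 3 dvd geom_poly n * H n - 1" if "n > 0" for n
    unfolding W_def H_def using geom_poly_inverse_mod_cube[OF that] .
  have "W ^ 3 dvd H a * H b * H c - h"
  proof -
    note trunc = cube_dvd_trunc_mult3[of W
        "[:1 / of_nat a:]" "[:(of_nat a - 1) / (2 * of_nat a):]" "[:((of_nat a)\<^sup>2 - 1) / (12 * of_nat a):]"
        "[:1 / of_nat b:]" "[:(of_nat b - 1) / (2 * of_nat b):]" "[:((of_nat b)\<^sup>2 - 1) / (12 * of_nat b):]"
        "[:1 / of_nat c:]" "[:(of_nat c - 1) / (2 * of_nat c):]" "[:((of_nat c)\<^sup>2 - 1) / (12 * of_nat c):]",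
        folded H_def]
    show ?thesis
      by (rule dvd_trans[OF trunc])
        (simp add: h_def e0_def e1_def e2_def p1_def p2_def A_def B_def C_def mult_ac)
  qed
  moreover have "W ^ 3 dvd geom_poly a * H a * (geom_poly b * H b) * (geom_poly c * H c) - 1"
    using pos by (intro dvd_mult_diff_one[OF dvd_mult_diff_one] inv)
  \<comment> \<open>Replacing the product of the three inverses by its truncation \<open>h\<close>
    costs only a multiple of \<open>W ^ 3\<close>.\<close>
  moreover have "E * h - 1 = (geom_poly a * H a * (geom_poly b * H b) * (geom_poly c * H c) - 1) - E * (H a * H b * H c - h)"
    by (simp add: E_def algebra_simps)
  ultimately have Eh: "W ^ 3 dvd E * h - 1" by (metis dvd_diff dvd_mult)
  have F: "F * fps_of_poly D = 1"
  proof -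
    have "F * fps_of_poly D = (multiples_fps a * fps_of_poly (1 - monom 1 a)) *
        (multiples_fps b * fps_of_poly (1 - monom 1 b)) * (multiples_fps c * fps_of_poly (1 - monom 1 c))"
      unfolding F_def D fps_of_poly_mult by (simp only: mult_ac)
    then show ?thesis using pos by (simp add: multiples_fps_mult)
  qed
  define q where "q = e0 * (real (n + 1) * real (n + 2) / 2) + e1 * real (n + 1) + e2"
  have "fps_nth F n = of_real q - (\<Sum>z\<in>S. 1 / (poly (pderiv D) z * z ^ (n + 1)))"
    using partial_fractions_coeff[OF S(1) cardS S(2,3) root simple[unfolded D_def W_def]
        Eh[unfolded h_def W_def] F[unfolded D_def W_def], of n]
    by (simp add: D_def W_def q_def)
  moreover have "fps_nth F n = 0" unfolding F_def using nonrep by (rule multiples_fps_nth_eq_0)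
  ultimately have "of_real q = (\<Sum>z\<in>S. 1 / (poly (pderiv D) z * z ^ (n + 1)))" by simp
  then have "\<bar>q\<bar> = norm (\<Sum>z\<in>S. 1 / (poly (pderiv D) z * z ^ (n + 1)))" by (metis norm_of_real)
  also have "\<dots> \<le> (\<Sum>z\<in>S. norm (1 / (poly (pderiv D) z * z ^ (n + 1))))" by (rule norm_sum)
  also have "\<dots> = (\<Sum>z\<in>nontriv_roots a. norm (1 / (poly (pderiv D) z * z ^ (n + 1))))
      + (\<Sum>z\<in>nontriv_roots b. norm (1 / (poly (pderiv D) z * z ^ (n + 1))))
      + (\<Sum>z\<in>nontriv_roots c. norm (1 / (poly (pderiv D) z * z ^ (n + 1))))"
    unfolding S_def using disj fin by (simp add: sum.union_disjoint)
  also have "\<dots> \<le> p2 A + p2 B + p2 C"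
    unfolding p2_def A_def B_def C_def by (intro add_mono bd)
  finally have "q \<le> p2 A + p2 B + p2 C" by simp
  then have "24 * (A * B * C) * q \<le> 24 * (A * B * C) * (p2 A + p2 B + p2 C)"
    by (intro mult_left_mono) (auto simp: A_def B_def C_def)
  moreover have ABC: "A \<ge> 1" "B \<ge> 1" "C \<ge> 1" using pos by (auto simp: A_def B_def C_def)
  \<comment> \<open>The factor \<open>24 * (A * B * C)\<close> clears all denominators on both
    sides.\<close>
  moreover have "24 * (A * B * C) * q = 12 * (real n)\<^sup>2 + 12 * real n * (A + B + C) + 6 * (A * B + B * C + A * C)
     + 2 * (A\<^sup>2 + B\<^sup>2 + C\<^sup>2)"
    unfolding q_def e0_def e1_def e2_def p1_def p2_def using ABC
    by (simp add: field_simps power2_eq_square)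
  moreover have "24 * (A * B * C) * (p2 A + p2 B + p2 C) = 2 * (A * B * C) * (A + B + C) - 2 * (A * B + B * C + A * C)"
    unfolding p2_def using ABC by (simp add: field_simps power2_eq_square)
  ultimately have main: "12 * (real n)\<^sup>2 + 12 * real n * (A + B + C) + 8 * (A * B + B * C + A * C)
     + 2 * (A\<^sup>2 + B\<^sup>2 + C\<^sup>2) \<le> 2 * (A * B * C) * (A + B + C)" by simp
  have le: "x\<^sup>2 \<le> x * y * z * x" if "x \<ge> 1" "y \<ge> 1" "z \<ge> 1" for x y z :: real
  proof -
    have "1 \<le> y * z" using that mult_mono[of 1 y 1 z] by simp
    then have "x\<^sup>2 * 1 \<le> x\<^sup>2 * (y * z)" by (intro mult_left_mono) auto
    then show ?thesis by (simp add: power2_eq_square mult_ac)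
  qed
  \<comment> \<open>Completing the square in \<open>main\<close> leaves one extra sum of squares on
    the right; this estimate absorbs it, which turns the factor 2 there into 3.\<close>
  have "A\<^sup>2 + B\<^sup>2 + C\<^sup>2 \<le> A * B * C * (A + B + C)"
    using le[of A B C] le[of B A C] le[of C A B] ABC by (simp add: distrib_left mult_ac)
  moreover have "A * B \<ge> 0" "B * C \<ge> 0" "A * C \<ge> 0" using ABC by auto
  ultimately have "3 * (2 * real n + A + B + C)\<^sup>2 \<le> 3 * (A * B * C * (A + B + C))"
    using main by (simp add: power2_eq_square algebra_simps)
  then show ?thesis by (simp add: A_def B_def C_def)
qed

section \<open>From the quadratic bound to the Frobenius number\<close>

text \<open>The set may be infinite below, so the maximum is taken over its finite part from the
  witness \<open>k\<close> upwards.\<close>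

lemma Greatest_int_satisfies:
  fixes P :: "int \<Rightarrow> bool"
  assumes "P k" and bound: "\<And>y. P y \<Longrightarrow> y \<le> m"
  shows "P (GREATEST y. P y)"
proof -
  have fin: "finite {y. P y \<and> k \<le> y}"
    by (rule finite_subset[of _ "{k..m}"]) (use bound in auto)
  have ne: "{y. P y \<and> k \<le> y} \<noteq> {}" using assms(1) by auto
  have M: "P (Max {y. P y \<and> k \<le> y})" using Max_in[OF fin ne] by auto
  have "y \<le> Max {y. P y \<and> k \<le> y}" if "P y" for y
  proof (cases "k \<le> y")
    case True
    then show ?thesis using that fin by auto
  next
    case False
    then show ?thesis using Max_ge[OF fin, of k] assms(1) by auto
  qed
  with M show ?thesis by (rule GreatestI2_order)
qed

text \<open>This is the quadratic bound for the value -1. It follows from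
  \<open>A * B * C \<ge> A + B + C - 2\<close>, obtained by using
  \<open>(x - 1) * (y - 1) \<ge> 0\<close> twice.\<close>

lemma square_sum_minus_2_le:
  fixes A B C :: real
  assumes "A \<ge> 1" "B \<ge> 1" "C \<ge> 1"
  shows "(A + B + C - 2)\<^sup>2 \<le> A * B * C * (A + B + C)"
proof -
  have "(A - 1) * (B - 1) \<ge> 0" using assms by simp
  then have AB: "A * B \<ge> A + B - 1" by (simp add: algebra_simps)
  then have "(A * B - 1) * (C - 1) \<ge> 0" using assms by (intro mult_nonneg_nonneg) linarith+
  then have "A * B * C \<ge> A * B + C - 1" by (simp add: algebra_simps)
  then have "A * B * C \<ge> A + B + C - 2" using AB by linarith
  then show ?thesis using assms unfolding power2_eq_square by (intro mult_mono) auto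
qed

theorem theorem2:
  fixes n :: nat and a :: "nat \<Rightarrow> nat"
  assumes "n \<ge> 3"
    and "\<And>i. i \<in> {1..n} \<Longrightarrow> a i > 0"
    and "mono_on {1..n} a"
    and "\<And>i j. i \<in> {1..n} \<Longrightarrow> j \<in> {1..n} \<Longrightarrow> i \<noteq> j \<Longrightarrow> coprime (a i) (a j)"
  shows "real_of_int (frobenius_number n a)
    \<le> 1 / 2 * (sqrt (real (a 1) * real (a 2) * real (a 3) * (real (a 1) + real (a 2) + real (a 3)))
               - real (a 1) - real (a 2) - real (a 3))"
proof -
  define A B C where "A = real (a 1)" and "B = real (a 2)" and "C = real (a 3)"
  define u where "u = 1 / 2 * (sqrt (A * B * C * (A + B + C)) - A - B - C)"
  define P where "P b \<longleftrightarrow> (\<forall>z::nat \<Rightarrow> nat. b \<noteq> (\<Sum>i=1..n. int (a i) * int (z i)))" for b :: int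
  have pos: "a 1 > 0" "a 2 > 0" "a 3 > 0" using assms(1,2) by auto
  have cop: "coprime (a 1) (a 2)" "coprime (a 1) (a 3)" "coprime (a 2) (a 3)"
    using assms(1) by (auto intro!: assms(4))
  have le_u: "real_of_int b \<le> u" if "(2 * real_of_int b + A + B + C)\<^sup>2 \<le> A * B * C * (A + B + C)" for b
    using real_le_rsqrt[OF that] by (simp add: u_def)
  have upper: "real_of_int b \<le> u" if b: "P b" for b
  proof (cases "b \<ge> 0")
    case True
    have "nat b \<noteq> a 1 * x + a 2 * y + a 3 * w" for x y w
    proof
      assume eq: "nat b = a 1 * x + a 2 * y + a 3 * w"
      \<comment> \<open>A representation by the first three entries is padded with zeros.\<close>
      define z where "z i = (if i = 1 then x else if i = 2 then y else if i = 3 then w else 0)" for i :: nat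
      have "(\<Sum>i=1..n. int (a i) * int (z i)) = (\<Sum>i\<in>{1, 2, 3}. int (a i) * int (z i))"
        using assms(1) by (intro sum.mono_neutral_right) (auto simp: z_def)
      also have "\<dots> = int (nat b)" unfolding eq by (simp add: z_def)
      finally show False using b True unfolding P_def by auto
    qed
    from nonrepresentable_quadratic_bound[OF pos cop this]
    show ?thesis using True by (intro le_u) (simp add: A_def B_def C_def)
  next
    case False
    \<comment> \<open>A negative \<open>b\<close> is at most -1, so it suffices to bound -1 by
      \<open>u\<close>.\<close>
    have "2 * real_of_int (- 1) + A + B + C = A + B + C - 2" by simp
    moreover have "(A + B + C - 2)\<^sup>2 \<le> A * B * C * (A + B + C)"
      using pos by (intro square_sum_minus_2_le) (auto simp: A_def B_def C_def)
    ultimately have "(2 * real_of_int (- 1) + A + B + C)\<^sup>2 \<le> A * B * C * (A + B + C)" by (simp only:)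
    then have "- 1 \<le> u" using le_u[of "-1"] by simp
    moreover have "real_of_int b \<le> - 1" using False by linarith
    ultimately show ?thesis by linarith
  qed
  have "P (-1)"
  proof -
    have "0 \<le> (\<Sum>i=1..n. int (a i) * int (z i))" for z :: "nat \<Rightarrow> nat" by (intro sum_nonneg) auto
    then show ?thesis unfolding P_def by (metis neg_0_le_iff_le not_one_le_zero)
  qed
  \<comment> \<open>The greatest element is sought among integers, so the real bound
    \<open>u\<close> is rounded down to an integer one.\<close>
  moreover have "b \<le> \<lfloor>u\<rfloor>" if "P b" for b using upper[OF that] by (simp add: le_floor_iff)
  ultimately have "P (GREATEST b. P b)" by (rule Greatest_int_satisfies)
  moreover have "frobenius_number n a = (GREATEST b. P b)"
    unfolding frobenius_number_def P_def ..
  ultimately show ?thesis using upper by (simp add: u_def A_def B_def C_def)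
qed

end
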